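(* Let $\mu>0$, let $0<a<2a<b<2b$, and let the pressure function $p$ satisfy $$p\Big(\frac1{at}\Big)=p\Big(\frac1{bt}\Big)\quad\text{for }t\in[1,2].$$ Then there is a sequence of weakly converging initial data (prescribed at $t=1$) so that the solution $(\rho_n,u_n)$ of the one-dimensional compressible Navier–Stokes system $$\rho_t+(\rho u)_y=0,\qquad (\rho u)_t+(\rho u^2+p(\rho))_y=\mu u_{yy}$$ has the property that $\rho_n\rightharpoonup\rho$ weakly (weak-$\ast$ in $L^\infty(Q)$, $Q=[1,2]\times(-1,1)$) while $u_n\to u$ strongly.
   Context: Here $\rho(t,y)$ is the density and $u(t,y)$ the velocity in Eulerian coordinates $(t,y)$, and $\mu$ is the viscosity. Solutions are weak solutions, satisfying both equations in the sense of distributions with initial data at $t=1$ attained in the weak form; they are considered for $t\in[1,2]$ and restricted to $y\in(-1,1)$. *)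

theory Defs
  imports "HOL-Analysis.Analysis"
begin

text \<open>Points of space-time are pairs \<open>(t, y)\<close>.\<close>

definition dt :: "(real \<times> real \<Rightarrow> real) \<Rightarrow> real \<times> real \<Rightarrow> real" where
  "dt f = (\<lambda>(t, y). deriv (\<lambda>s. f (s, y)) t)"

definition dy :: "(real \<times> real \<Rightarrow> real) \<Rightarrow> real \<times> real \<Rightarrow> real" where
  "dy f = (\<lambda>(t, y). deriv (\<lambda>z. f (t, z)) y)"

text \<open>Coinductively: all iterated partial derivatives, in every order, are differentiable
  (hence continuous) on the whole plane.\<close>

coinductive smooth :: "(real \<times> real \<Rightarrow> real) \<Rightarrow> bool" where
  "(\<forall>x. f differentiable (at x)) \<Longrightarrow> smooth (dt f) \<Longrightarrow> smooth (dy f) \<Longrightarrow> smooth f"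

text \<open>Restricted to \<open>t \<ge> 1\<close> these are the test functions of class \<open>C\<^sub>c\<^sup>\<infinity>\<close> on
  \<open>[1,2) \<times> \<real>\<close>: they vanish near \<open>t = 2\<close> but not necessarily at the initial time \<open>t = 1\<close>.\<close>

definition test_function :: "(real \<times> real \<Rightarrow> real) \<Rightarrow> bool" where
  "test_function \<phi> \<longleftrightarrow>
     smooth \<phi> \<and> compact (closure {x. \<phi> x \<noteq> 0}) \<and> closure {x. \<phi> x \<noteq> 0} \<subseteq> {..<2} \<times> UNIV"

definition locally_integrable_on :: "('a::euclidean_space \<Rightarrow> real) \<Rightarrow> 'a set \<Rightarrow> bool" where
  "locally_integrable_on f S \<longleftrightarrow> (\<forall>K. compact K \<and> K \<subseteq> S \<longrightarrow> set_integrable lborel K f)"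

definition strip :: "(real \<times> real) set" where
  "strip = {1..2} \<times> UNIV"

definition Q :: "(real \<times> real) set" where
  "Q = {1..2} \<times> {-1<..<1}"

text \<open>Distributional solutions of
  \[ \rho_t + (\rho u)_y = 0, \qquad (\rho u)_t + (\rho u^2 + p(\rho))_y = \mu u_{yy} \]
  on \<open>[1,2] \<times> \<real>\<close> with data \<open>(\<rho>0, \<rho>0 u0)\<close> for \<open>(\<rho>, \<rho> u)\<close> at \<open>t = 1\<close>.
  The integrability conditions make every integral below convergent.\<close>

definition weak_solution ::
  "(real \<Rightarrow> real) \<Rightarrow> real \<Rightarrow> (real \<Rightarrow> real) \<Rightarrow> (real \<Rightarrow> real) \<Rightarrow>
   (real \<times> real \<Rightarrow> real) \<Rightarrow> (real \<times> real \<Rightarrow> real) \<Rightarrow> bool" where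
  "weak_solution p \<mu> \<rho>0 u0 \<rho> u \<longleftrightarrow>
     (AE y in lborel. 0 < \<rho>0 y) \<and>
     (AE x in lborel. x \<in> strip \<longrightarrow> 0 < \<rho> x) \<and>
     locally_integrable_on \<rho>0 UNIV \<and>
     locally_integrable_on (\<lambda>y. \<rho>0 y * u0 y) UNIV \<and>
     locally_integrable_on \<rho> strip \<and>
     locally_integrable_on u strip \<and>
     locally_integrable_on (\<lambda>x. \<rho> x * u x) strip \<and>
     locally_integrable_on (\<lambda>x. \<rho> x * (u x)\<^sup>2) strip \<and>
     locally_integrable_on (\<lambda>x. p (\<rho> x)) strip \<and>
     (\<forall>\<phi>. test_function \<phi> \<longrightarrow>
        (LINT x:strip|lborel. \<rho> x * dt \<phi> x + \<rho> x * u x * dy \<phi> x)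
          + (LINT y|lborel. \<rho>0 y * \<phi> (1, y)) = 0 \<and>
        (LINT x:strip|lborel. \<rho> x * u x * dt \<phi> x + (\<rho> x * (u x)\<^sup>2 + p (\<rho> x)) * dy \<phi> x
                                + \<mu> * u x * dy (dy \<phi>) x)
          + (LINT y|lborel. \<rho>0 y * u0 y * \<phi> (1, y)) = 0)"

definition in_Linfty :: "'a::euclidean_space set \<Rightarrow> ('a \<Rightarrow> real) \<Rightarrow> bool" where
  "in_Linfty S f \<longleftrightarrow>
     set_borel_measurable lborel S f \<and> (\<exists>C. AE x in lborel. x \<in> S \<longrightarrow> \<bar>f x\<bar> \<le> C)"

definition weak_star_converges ::
  "'a::euclidean_space set \<Rightarrow> (nat \<Rightarrow> 'a \<Rightarrow> real) \<Rightarrow> ('a \<Rightarrow> real) \<Rightarrow> bool" where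
  "weak_star_converges S f g \<longleftrightarrow>
     (\<forall>n. in_Linfty S (f n)) \<and> in_Linfty S g \<and>
     (\<forall>h. set_integrable lborel S h \<longrightarrow>
        (\<lambda>n. LINT x:S|lborel. f n x * h x) \<longlonglongrightarrow> (LINT x:S|lborel. g x * h x))"

definition in_Lp :: "real \<Rightarrow> 'a::euclidean_space set \<Rightarrow> ('a \<Rightarrow> real) \<Rightarrow> bool" where
  "in_Lp r S f \<longleftrightarrow>
     set_borel_measurable lborel S f \<and> set_integrable lborel S (\<lambda>x. \<bar>f x\<bar> powr r)"

definition Lp_converges ::
  "real \<Rightarrow> 'a::euclidean_space set \<Rightarrow> (nat \<Rightarrow> 'a \<Rightarrow> real) \<Rightarrow> ('a \<Rightarrow> real) \<Rightarrow> bool" where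
  "Lp_converges r S f g \<longleftrightarrow>
     (\<forall>n. in_Lp r S (f n)) \<and> in_Lp r S g \<and>
     (\<lambda>n. LINT x:S|lborel. \<bar>f n x - g x\<bar> powr r) \<longlonglongrightarrow> 0"

end

theory Submission
  imports Defs
begin

text \<open>The velocity \<open>u = y/t\<close> transports every density of the form \<open>r(y/t)/t\<close>, has no acceleration,
  and is affine in \<open>y\<close>, so it feels no viscous force. If \<open>r\<close> takes only the values \<open>1/a\<close> and
  \<open>1/b\<close>, then the hypothesis on \<open>p\<close> makes the pressure a function of \<open>t\<close> alone, so no force remains
  and the momentum equation holds however fast \<open>r\<close> oscillates. A square wave of increasing frequency
  therefore gives densities that converge only weakly, with the velocity fixed.\<close>

section \<open>Weak convergence of the square wave to zero\<close>

text \<open>Weak-* convergence is tested against every integrable \<open>h\<close>, not just smooth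
  ones, so the oscillation result is built up from half-lines to Borel sets and then to integrable
  functions; that the wave has modulus 1 keeps all errors uniform in the frequency. The same fact
  makes the strong distance to the limit independent of \<open>n\<close>, which rules out strong
  convergence. In space-time the wave depends on \<open>y / t\<close> alone; the substitution
  \<open>y = t * z\<close> undoes this on each time slice, and since \<open>t \<ge> 1\<close> the
  region \<open>Q\<close> stays within \<open>\<bar>z\<bar> \<le> 1\<close>. This is why the
  one-dimensional lemmas live on \<open>{-1..1}\<close>. The density jumps, so the equations are
  verified against test functions along the rays \<open>y = t * z\<close>, where no derivative of
  \<open>r\<close> appears. The pressure \<open>p\<close> is only locally integrable and may be
  unbounded or discontinuous, so integrability of \<open>p (\<rho> x)\<close> comes from a change of
  variable rather than from bounds.\<close>

definition square_wave :: "nat \<Rightarrow> real \<Rightarrow> real" where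
  "square_wave n z = (if even \<lfloor>real (Suc n) * z\<rfloor> then 1 else - 1)"

lemma abs_square_wave [simp]: "\<bar>square_wave n z\<bar> = 1"
  by (simp add: square_wave_def)

lemma square_wave_measurable [measurable]: "square_wave n \<in> borel_measurable borel"
  unfolding square_wave_def by measurable

lemma square_wave_shift: "square_wave n (1 / real (Suc n) + z) = - square_wave n z"
proof -
  have "real (Suc n) * (1 / real (Suc n) + z) = real (Suc n) * z + 1"
    by (simp add: field_simps)
  then show ?thesis
    unfolding square_wave_def by simp
qed

lemma integrable_square_wave_mult:
  assumes "integrable lborel h"
  shows "integrable lborel (\<lambda>z. square_wave n z * h z)"
  by (rule Bochner_Integration.integrable_bound[OF assms])
    (use borel_measurable_integrable[OF assms] in \<open>auto simp: abs_mult\<close>)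

text \<open>A shift by half a period flips the sign of the wave, so twice the integral over an interval
  is an integral over two end pieces of length \<open>1 / (n + 1)\<close>.\<close>

lemma square_wave_interval_bound:
  "\<bar>LINT z|lborel. square_wave n z * indicator {-1..min x 1} z\<bar> \<le> 1 / real (Suc n)"
proof -
  define d where "d = 1 / real (Suc n)"
  define I where "I = (\<lambda>h::real \<Rightarrow> real. LINT z|lborel. square_wave n z * h z)"
  \<comment> \<open>This is \<open>{..x} \<inter> {-1..1}\<close>; it is empty for
    \<open>x < -1\<close>.\<close>
  define S where "S = {-1..min x 1} "
  define S' where "S' = (+) (-d) ` S"
  have d: "0 < d" by (simp add: d_def)
  have S': "S' = {-1-d..min x 1 - d}" unfolding S'_def S_def by simp
  have [measurable]: "S \<in> sets borel" "S' \<in> sets borel" by (auto simp: S_def S')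
  have int: "integrable lborel (indicator S :: real \<Rightarrow> real)"
    "integrable lborel (indicator S' :: real \<Rightarrow> real)"
    by (auto simp: S_def S' emeasure_lborel_Icc_eq intro!: integrable_real_indicator)
  have shift: "square_wave n (d + z) = - square_wave n z" for z
    unfolding d_def by (rule square_wave_shift)
  have "I (indicator S) = (LINT z|lborel. square_wave n (d + 1 * z) * indicator S (d + 1 * z))"
    unfolding I_def by (subst lborel_integral_real_affine[where c=1 and t=d]) auto
  also have "\<dots> = (LINT z|lborel. - (square_wave n z * indicator S' z))"
    by (intro Bochner_Integration.integral_cong refl)
       (auto simp: shift S_def S' indicator_def)
  also have "\<dots> = - I (indicator S')"
    by (simp add: I_def)
  finally have "2 * I (indicator S) = I (indicator S) - I (indicator S')" by simp
  also have "\<dots> = (LINT z|lborel. square_wave n z * (indicator S z - indicator S' z))"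
    unfolding I_def
    by (subst Bochner_Integration.integral_diff[symmetric])
       (auto intro!: integrable_square_wave_mult int simp: right_diff_distrib)
  finally have "2 * \<bar>I (indicator S)\<bar> = \<bar>LINT z|lborel. square_wave n z * (indicator S z - indicator S' z)\<bar>"
    by (simp add: abs_mult)
  also have "\<dots> \<le> (LINT z|lborel. \<bar>indicator S z - indicator S' z\<bar>)"
    by (rule order_trans[OF integral_abs_bound]) (simp add: abs_mult)
  \<comment> \<open>The two intervals cover the symmetric difference of \<open>S\<close> and its
    translate. This remains true if \<open>S\<close> is empty or shorter than
    \<open>d\<close>.\<close>
  also have "\<dots> \<le> (LINT z|lborel. indicator {-1-d..-1} z + indicator {min x 1 - d..min x 1} z)"
    by (intro integral_mono integrable_abs Bochner_Integration.integrable_diff int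
        Bochner_Integration.integrable_add integrable_real_indicator)
      (use d in \<open>auto simp: S_def S' indicator_def emeasure_lborel_Icc_eq\<close>)
  also have "\<dots> = 2 * d"
    using d by (subst Bochner_Integration.integral_add)
      (auto intro!: integrable_real_indicator simp: emeasure_lborel_Icc_eq)
  finally show ?thesis by (simp add: I_def S_def d_def)
qed

text \<open>A pi-lambda argument: the half-lines \<open>{..x}\<close> form an intersection-stable
  generator, and the limit survives complements and disjoint unions. Intersecting with
  \<open>{-1..1}\<close> keeps all measures finite, which both closure steps use.\<close>

lemma square_wave_indicator_tendsto_0:
  assumes "A \<in> sets borel"
  shows "(\<lambda>n. LINT z|lborel. square_wave n z * indicator (A \<inter> {-1..1}) z) \<longlonglongrightarrow> 0"
proof -
  have int: "integrable lborel (\<lambda>z. square_wave n z * indicator (A \<inter> {-1..1}) z)"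
    if "A \<in> sets borel" for n A
    using that by (intro integrable_square_wave_mult integrable_real_indicator)
      (auto intro: order.strict_trans1[OF emeasure_mono[of _ "{-1..1}"]])
  have sub: "range (\<lambda>x::real. {..x}) \<subseteq> Pow UNIV" by simp
  have Int: "Int_stable (range (\<lambda>x::real. {..x}))"
    by (auto simp: Int_stable_def)
  have borel: "sigma_sets UNIV (range (\<lambda>x::real. {..x})) = sets borel"
    unfolding borel_eq_atMost by simp
  have "A \<in> sigma_sets UNIV (range (\<lambda>x::real. {..x}))"
    using assms unfolding borel .
  with Int sub show ?thesis
  proof (induction rule: sigma_sets_induct_disjoint)
    case (basic A)
    then obtain x where A: "A = {..x}" by auto
    have "A \<inter> {-1..1} = {-1..min x 1}" by (auto simp: A)
    then show ?case
      using square_wave_interval_bound[of _ x]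
      by (intro Lim_null_comparison[OF always_eventually LIMSEQ_Suc[OF lim_1_over_n]]) simp
  next
    case empty
    then show ?case by simp
  next
    case (compl A)
    then have A: "A \<in> sets borel" unfolding borel by simp
    have "(LINT z|lborel. square_wave n z * indicator ((UNIV - A) \<inter> {-1..1}) z) =
      (LINT z|lborel. square_wave n z * indicator {-1..1} z)
       - (LINT z|lborel. square_wave n z * indicator (A \<inter> {-1..1}) z)" for n
      using Bochner_Integration.integral_diff[OF int[of UNIV n] int[OF A, of n]]
      by (simp, subst (asm) Bochner_Integration.integral_cong[OF refl,
          of lborel _ "\<lambda>z. square_wave n z * indicator ((UNIV - A) \<inter> {-1..1}) z"])
        (auto simp: indicator_def)
    moreover have "(\<lambda>n. LINT z|lborel. square_wave n z * indicator {-1..1} z) \<longlonglongrightarrow> 0"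
      using square_wave_interval_bound[of _ 1]
      by (intro Lim_null_comparison[OF always_eventually LIMSEQ_Suc[OF lim_1_over_n]]) simp
    ultimately show ?case
      using tendsto_diff compl.IH by fastforce
  next
    case (union A)
    define B where "B k = A k \<inter> {-1..1}" for k
    have A: "A k \<in> sets borel" for k using union.hyps unfolding borel by auto
    have B: "B k \<in> sets borel" for k using A by (simp add: B_def)
    have disj: "disjoint_family B"
      using union.hyps(1) by (auto simp: disjoint_family_on_def B_def)
    have UB: "\<Union> (range A) \<inter> {-1..1} = \<Union> (range B)" by (auto simp: B_def)
    have fin: "emeasure lborel (\<Union> (range B)) < \<infinity>"
      by (rule order.strict_trans1[OF emeasure_mono[of _ "{-1..1}"]]) (auto simp: B_def)
    have sums: "summable (\<lambda>k. measure lborel (B k))"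
      using measure_UNION[OF _ disj, of lborel] fin B
      by (auto simp: image_subset_iff sums_iff)
    have bound: "\<bar>LINT z|lborel. square_wave n z * indicator (B k) z\<bar> \<le> measure lborel (B k)" for n k
      by (rule order_trans[OF integral_abs_bound]) (use B in \<open>simp add: abs_mult\<close>)
    have "(LINT z|lborel. square_wave n z * indicator (\<Union> (range B)) z)
       = (\<Sum>k. LINT z|lborel. square_wave n z * indicator (B k) z)" for n
      using lebesgue_integral_countable_add[of B lborel "square_wave n"] B disj
        int[of "\<Union> (range A)" n] A unfolding UB
      by (simp add: set_lebesgue_integral_def set_integrable_def disjoint_family_on_def mult.commute)
    \<comment> \<open>Tannery's theorem exchanges the limit with the sum. The majorant
      \<open>measure lborel (B k)\<close> is independent of \<open>n\<close>, and it is summable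
      because the disjoint sets \<open>B k\<close> all lie in \<open>{-1..1}\<close>.\<close>
    moreover have "(\<lambda>n. \<Sum>k. LINT z|lborel. square_wave n z * indicator (B k) z) \<longlonglongrightarrow> (\<Sum>k::nat. 0)"
      using tannerys_theorem[of "\<lambda>k n. LINT z|lborel. square_wave n z * indicator (B k) z" "\<lambda>_. 0"
        sequentially "\<lambda>k. measure lborel (B k)"] union.IH sums bound
      by (simp add: B_def case_prod_unfold)
    ultimately show ?case by (simp add: UB)
  qed
qed

text \<open>Induction over integrable functions. The passage to a limit works because replacing
  \<open>f\<close> by \<open>s i\<close> changes the integral by at most their distance in the mean,
  whatever the frequency.\<close>

lemma square_wave_weakly_null_unit_interval:
  assumes "integrable lborel h"
  shows "(\<lambda>n. LINT z|lborel. square_wave n z * (h z * indicator {-1..1} z)) \<longlonglongrightarrow> 0"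
  using assms
proof induction
  case (base A c)
  have "(LINT z|lborel. square_wave n z * ((indicator A z *\<^sub>R c) * indicator {-1..1} z))
     = c * (LINT z|lborel. square_wave n z * indicator (A \<inter> {-1..1}) z)" for n
    unfolding integral_mult_right_zero[symmetric]
    by (rule Bochner_Integration.integral_cong) (auto simp: indicator_def)
  then show ?case
    using tendsto_mult_right_zero[OF square_wave_indicator_tendsto_0] base by simp
next
  case (add f g)
  have "(LINT z|lborel. square_wave n z * ((f z + g z) * indicator {-1..1} z))
    = (LINT z|lborel. square_wave n z * (f z * indicator {-1..1} z))
      + (LINT z|lborel. square_wave n z * (g z * indicator {-1..1} z))" for n
    using add.hyps
    by (subst Bochner_Integration.integral_add[symmetric])
      (auto intro!: integrable_square_wave_mult integrable_real_mult_indicator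
        simp: distrib_left distrib_right)
  then show ?case using tendsto_add[OF add.IH] by simp
next
  case (lim f s)
  let ?I = "\<lambda>h n. LINT z|lborel. square_wave n z * (h z * indicator {-1..1} z)"
  have "(\<lambda>i. LINT z|lborel. \<bar>s i z - f z\<bar>) \<longlonglongrightarrow> (LINT (z::real)|lborel. 0)"
  proof (rule integral_dominated_convergence[where w="\<lambda>z. 3 * \<bar>f z\<bar>"])
    show "AE z in lborel. (\<lambda>i. \<bar>s i z - f z\<bar>) \<longlonglongrightarrow> 0"
      using lim.hyps(2) by (auto simp: LIM_zero_iff tendsto_rabs_zero_iff)
    \<comment> \<open>The induction rule supplies
      \<open>\<bar>s i z\<bar> \<le> 2 * \<bar>f z\<bar>\<close>; adding
      \<open>\<bar>f z\<bar>\<close> gives the factor 3.\<close>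
    show "AE z in lborel. norm \<bar>s i z - f z\<bar> \<le> 3 * \<bar>f z\<bar>" for i
    proof (rule AE_I2)
      fix z show "norm \<bar>s i z - f z\<bar> \<le> 3 * \<bar>f z\<bar>"
        using lim.hyps(3)[of z i] by auto
    qed
  qed (use lim.hyps in auto)
  then have L1: "(\<lambda>i. LINT z|lborel. \<bar>s i z - f z\<bar>) \<longlonglongrightarrow> 0" by simp
  \<comment> \<open>The bound does not involve \<open>n\<close>, so the approximation index
    \<open>i\<close> can be fixed before the threshold \<open>N\<close> is chosen.\<close>
  have diff: "\<bar>?I f n - ?I (s i) n\<bar> \<le> (LINT z|lborel. \<bar>s i z - f z\<bar>)" for i n
  proof -
    have "?I f n - ?I (s i) n = (LINT z|lborel. square_wave n z * ((f z - s i z) * indicator {-1..1} z))"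
      using lim.hyps
      by (subst Bochner_Integration.integral_diff[symmetric])
         (auto intro!: integrable_square_wave_mult integrable_real_mult_indicator simp: left_diff_distrib right_diff_distrib)
    also have "\<bar>\<dots>\<bar> \<le> (LINT z|lborel. \<bar>(f z - s i z) * indicator {-1..1} z\<bar>)"
      by (rule order_trans[OF integral_abs_bound]) (simp add: abs_mult)
    also have "\<dots> \<le> (LINT z|lborel. \<bar>s i z - f z\<bar>)"
      using lim.hyps by (intro integral_mono integrable_abs integrable_real_mult_indicator)
        (auto simp: indicator_def)
    finally show ?thesis .
  qed
  show ?case
  proof (rule LIMSEQ_I)
    fix e :: real assume "0 < e"
    then obtain i where i: "(LINT z|lborel. \<bar>s i z - f z\<bar>) < e / 2"
      using order_tendstoD(2)[OF L1, of "e/2"] by (auto simp: eventually_sequentially)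
    obtain N where "\<And>n. n \<ge> N \<Longrightarrow> \<bar>?I (s i) n\<bar> < e / 2"
      using LIMSEQ_D[OF lim.IH[of i], of "e/2"] \<open>0 < e\<close> by auto
    then show "\<exists>N. \<forall>n\<ge>N. norm (?I f n - 0) < e"
      using diff[of _ i] i by (intro exI[of _ N]) (smt (verit) field_sum_of_halves real_norm_def)
  qed
qed

section \<open>From the interval to the space-time region\<close>

lemma borel_measurable_fst_plane [measurable]:
  "fst \<in> borel_measurable (borel :: (real \<times> real) measure)"
  and borel_measurable_snd_plane [measurable]:
  "snd \<in> borel_measurable (borel :: (real \<times> real) measure)"
  by (auto intro!: borel_measurable_continuous_onI continuous_intros)

lemma strip_measurable [measurable]: "strip \<in> sets borel"
  unfolding strip_def by (intro borel_closed closed_Times) auto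

lemma Q_measurable [measurable]: "Q \<in> sets borel"
  unfolding Q_def borel_prod[symmetric] by (intro pair_measureI) auto

lemma integral_lborel_iterated:
  fixes f :: "real \<times> real \<Rightarrow> real"
  assumes "integrable lborel f"
  shows "(LINT x|lborel. f x) = (LINT t|lborel. LINT y|lborel. f (t, y))"
  using lborel_pair.integral_fst'[of f] assms by (simp add: lborel_prod)

text \<open>By Fubini the integral is that of \<open>I n t\<close> over \<open>t\<close>. On almost
  every slice \<open>y = t * z\<close> reduces \<open>I n t\<close> to the one-dimensional
  statement, and the slice integral of \<open>\<bar>g\<bar>\<close> dominates for all
  \<open>n\<close>, so dominated convergence in \<open>t\<close> finishes.\<close>

lemma square_wave_weakly_null_Q:
  assumes "set_integrable lborel Q h"
  shows "(\<lambda>n. LINT x|lborel. square_wave n (snd x / fst x) * (indicator Q x * h x)) \<longlonglongrightarrow> 0"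
proof -
  define g where "g x = indicator Q x * h x" for x
  have g: "integrable lborel g"
    using assms by (simp add: g_def[abs_def] set_integrable_def)
  then have [measurable]: "g \<in> borel_measurable borel" by auto
  define I where "I n t = (LINT y|lborel. square_wave n (y / t) * g (t, y))" for n t
  have int: "integrable lborel (\<lambda>x. square_wave n (snd x / fst x) * g x)" for n
    by (rule Bochner_Integration.integrable_bound[OF g]) (auto simp: abs_mult)
  have slices: "AE t in lborel. integrable lborel (\<lambda>y. g (t, y))"
    using lborel_pair.AE_integrable_fst'[of g] g by (simp add: lborel_prod)
  have bound: "AE t in lborel. norm (I n t) \<le> (LINT y|lborel. \<bar>g (t, y)\<bar>)" for n
    by (rule AE_I2) (unfold I_def real_norm_def, rule order_trans[OF integral_abs_bound], simp add: abs_mult)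
  have lim: "AE t in lborel. (\<lambda>n. I n t) \<longlonglongrightarrow> 0"
    using slices
  proof eventually_elim
    case (elim t)
    show ?case
    proof (cases "t \<in> {1..2}")
      case True
      have "I n t = t * (LINT z|lborel. square_wave n z * (g (t, t * z) * indicator {-1..1} z))" for n
      proof -
        have "I n t = t * (LINT z|lborel. square_wave n ((0 + t * z) / t) * g (t, 0 + t * z))"
          unfolding I_def using True by (subst lborel_integral_real_affine[of t _ 0]) auto
        also have "(LINT z|lborel. square_wave n ((0 + t * z) / t) * g (t, 0 + t * z)) =
            (LINT z|lborel. square_wave n z * (g (t, t * z) * indicator {-1..1} z))"
        proof (rule Bochner_Integration.integral_cong[OF refl])
          fix z :: real
          \<comment> \<open>Because \<open>t \<ge> 1\<close>, the slice of \<open>Q\<close> in the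
            variable \<open>z\<close> lies inside \<open>{-1..1}\<close>, so inserting the cutoff
            changes nothing.\<close>
          have "g (t, t * z) = 0" if "z \<notin> {-1..1}"
          proof -
            have "1 * 1 \<le> t * \<bar>z\<bar>" using that True by (intro mult_mono) auto
            then have "1 \<le> \<bar>t * z\<bar>" using True by (simp add: abs_mult)
            then have "(t, t * z) \<notin> Q" by (auto simp: Q_def)
            then show ?thesis by (simp add: g_def)
          qed
          then show "square_wave n ((0 + t * z) / t) * g (t, 0 + t * z) =
            square_wave n z * (g (t, t * z) * indicator {-1..1} z)"
            using True by (auto simp: indicator_def)
        qed
        finally show ?thesis .
      qed
      moreover have "integrable lborel (\<lambda>z. g (t, t * z))"
        using lborel_integrable_real_affine[OF elim, of t 0] True by simp
      ultimately show ?thesis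
        using tendsto_mult_right_zero[OF square_wave_weakly_null_unit_interval] by simp
    next
      case False
      then have "g (t, y) = 0" for y by (auto simp: g_def Q_def)
      then show ?thesis by (simp add: I_def)
    qed
  qed
  have "(\<lambda>n. LINT t|lborel. I n t) \<longlonglongrightarrow> (LINT (t::real)|lborel. 0)"
  proof (rule integral_dominated_convergence[OF _ _ _ lim bound])
    show "integrable lborel (\<lambda>t. LINT y|lborel. \<bar>g (t, y)\<bar>)"
      using lborel_pair.integrable_fst'[of "\<lambda>x. \<bar>g x\<bar>"] g by (simp add: lborel_prod)
    show "I n \<in> borel_measurable lborel" for n
      using lborel_pair.integrable_fst'[of "\<lambda>x. square_wave n (snd x / fst x) * g x"] int[of n]
      by (auto simp: lborel_prod I_def[abs_def])
  qed simp
  then show ?thesis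
    using integral_lborel_iterated[OF int] by (simp add: I_def g_def)
qed

section \<open>Test functions\<close>

lemma smooth_differentiable:
  assumes "smooth f"
  shows "f differentiable (at x)"
  using assms
proof cases
  case 1
  then show ?thesis by metis
qed

lemma smooth_partials:
  assumes "smooth f"
  shows smooth_dt: "smooth (dt f)" and smooth_dy: "smooth (dy f)"
proof -
  show "smooth (dt f)"
    using assms
  proof cases
    case 1
    show ?thesis by fact
  qed
  show "smooth (dy f)"
    using assms
  proof cases
    case 1
    show ?thesis by fact
  qed
qed

lemma test_function_smooth: "test_function \<phi> \<Longrightarrow> smooth \<phi>"
  by (simp add: test_function_def)

lemma test_function_differentiable: "test_function \<phi> \<Longrightarrow> \<phi> differentiable (at x)"
  by (intro smooth_differentiable test_function_smooth)

lemma test_function_isCont: "test_function \<phi> \<Longrightarrow> isCont \<phi> x"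
  by (rule differentiable_imp_continuous_within[OF test_function_differentiable])

lemma test_function_continuous_on: "test_function \<phi> \<Longrightarrow> continuous_on S \<phi>"
  by (intro continuous_at_imp_continuous_on ballI test_function_isCont)

lemma test_function_measurable [measurable_dest]: "test_function \<phi> \<Longrightarrow> \<phi> \<in> borel_measurable borel"
  by (intro borel_measurable_continuous_onI test_function_continuous_on)

text \<open>Meant for \<open>\<psi>\<close> a partial derivative of \<open>\<phi>\<close>. Checking
  zeros off the closed support is enough, since a closed set containing
  \<open>{x. \<psi> x \<noteq> 0}\<close> contains its closure.\<close>

lemma test_function_closure_subset:
  assumes "test_function \<phi>" "smooth \<psi>" "\<And>x. x \<notin> closure {x. \<phi> x \<noteq> 0} \<Longrightarrow> \<psi> x = 0"
  shows "test_function \<psi>"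
proof -
  have "closure {x. \<psi> x \<noteq> 0} \<subseteq> closure {x. \<phi> x \<noteq> 0}"
    using assms(3) by (intro closure_minimal) auto
  moreover from this have "compact (closure {x. \<psi> x \<noteq> 0})"
    using assms(1) compact_Int_closed[of "closure {x. \<phi> x \<noteq> 0}" "closure {x. \<psi> x \<noteq> 0}"]
    unfolding test_function_def by (simp add: inf.absorb2)
  ultimately show ?thesis
    using assms by (auto simp: test_function_def)
qed

text \<open>Applied with \<open>c\<close> a coordinate line: the slice of \<open>\<phi>\<close> is
  then locally zero, and so is the \<open>deriv\<close> that defines \<open>dt\<close> or
  \<open>dy\<close>.\<close>

lemma zero_near_outside_closure:
  fixes \<phi> :: "real \<times> real \<Rightarrow> real"
  assumes "c s \<notin> closure {x. \<phi> x \<noteq> 0}" "isCont c s"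
  shows "eventually (\<lambda>r. \<phi> (c r) = 0) (nhds s)"
proof -
  have "(c \<longlongrightarrow> c s) (nhds s)"
    using assms(2) unfolding isCont_def tendsto_at_iff_tendsto_nhds .
  moreover have "open (- closure {x. \<phi> x \<noteq> 0})" by (rule open_Compl) simp
  ultimately have "eventually (\<lambda>r. c r \<in> - closure {x. \<phi> x \<noteq> 0}) (nhds s)"
    by (rule topological_tendstoD) (use assms(1) in simp)
  then show ?thesis
  proof eventually_elim
    case (elim r)
    then show ?case using closure_subset[of "{x. \<phi> x \<noteq> 0}"] by auto
  qed
qed

lemma test_function_dt:
  assumes "test_function \<phi>"
  shows "test_function (dt \<phi>)"
proof (rule test_function_closure_subset[OF assms])
  show "smooth (dt \<phi>)"
    by (intro smooth_dt test_function_smooth assms)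
  show "dt \<phi> x = 0" if "x \<notin> closure {x. \<phi> x \<noteq> 0}" for x
  proof (cases x)
    case (Pair t y)
    have "eventually (\<lambda>s. \<phi> (s, y) = 0) (nhds t)"
      using that Pair zero_near_outside_closure[of "\<lambda>s. (s, y)" t \<phi>] by auto
    then have "deriv (\<lambda>s. \<phi> (s, y)) t = deriv (\<lambda>_. 0) t"
      by (intro deriv_cong_ev) auto
    then show ?thesis by (simp add: dt_def Pair)
  qed
qed

lemma test_function_dy:
  assumes "test_function \<phi>"
  shows "test_function (dy \<phi>)"
proof (rule test_function_closure_subset[OF assms])
  show "smooth (dy \<phi>)"
    by (intro smooth_dy test_function_smooth assms)
  show "dy \<phi> x = 0" if "x \<notin> closure {x. \<phi> x \<noteq> 0}" for x
  proof (cases x)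
    case (Pair t y)
    have "eventually (\<lambda>z. \<phi> (t, z) = 0) (nhds y)"
      using that Pair zero_near_outside_closure[of "\<lambda>z. (t, z)" y \<phi>] by auto
    then have "deriv (\<lambda>z. \<phi> (t, z)) y = deriv (\<lambda>_. 0) y"
      by (intro deriv_cong_ev) auto
    then show ?thesis by (simp add: dy_def Pair)
  qed
qed

lemma test_function_bounded:
  assumes "test_function \<phi>"
  obtains C where "0 < C" "\<And>x. \<bar>\<phi> x\<bar> \<le> C"
proof -
  define K where "K = closure {x. \<phi> x \<noteq> 0}"
  have "bounded (\<phi> ` K)"
    using assms by (intro compact_imp_bounded compact_continuous_image test_function_continuous_on)
      (simp_all add: test_function_def K_def)
  then obtain C where C: "0 < C" "\<And>x. x \<in> K \<Longrightarrow> \<bar>\<phi> x\<bar> \<le> C"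
    unfolding bounded_pos by auto
  have "\<bar>\<phi> x\<bar> \<le> C" for x
  proof (cases "\<phi> x = 0")
    case False
    then have "x \<in> K" using closure_subset[of "{x. \<phi> x \<noteq> 0}"] by (auto simp: K_def)
    then show ?thesis by (rule C(2))
  qed (use C in auto)
  with C(1) show ?thesis by (rule that)
qed

lemma test_function_support:
  assumes "test_function \<phi>"
  obtains R where "0 < R" "\<And>t y. R \<le> \<bar>y\<bar> \<Longrightarrow> \<phi> (t, y) = 0" "\<And>t y. 2 \<le> t \<Longrightarrow> \<phi> (t, y) = 0"
proof -
  define K where "K = closure {x. \<phi> x \<noteq> 0}"
  have "bounded K" "K \<subseteq> {..<2} \<times> UNIV"
    using assms compact_imp_bounded by (auto simp: test_function_def K_def)
  then obtain R where R: "0 < R" "\<And>x. x \<in> K \<Longrightarrow> norm x \<le> R"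
    unfolding bounded_pos by auto
  have supp: "(t, y) \<in> K" if "\<phi> (t, y) \<noteq> 0" for t y
    using that closure_subset[of "{x. \<phi> x \<noteq> 0}"] by (auto simp: K_def)
  show ?thesis
  \<comment> \<open>The bound \<open>norm x \<le> R\<close> on the support is not strict, while
    \<open>\<phi>\<close> has to vanish already where \<open>\<bar>y\<bar>\<close> equals the chosen
    radius.\<close>
  proof (rule that[of "R + 1"])
    show "0 < R + 1" using R by simp
    show "\<phi> (t, y) = 0" if "R + 1 \<le> \<bar>y\<bar>" for t y
    proof (rule ccontr)
      assume "\<phi> (t, y) \<noteq> 0"
      then have "norm (t, y) \<le> R" by (intro R supp)
      then show False using norm_snd_le[of y t] that by simp
    qed
    show "\<phi> (t, y) = 0" if "2 \<le> t" for t y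
    proof (rule ccontr)
      assume "\<phi> (t, y) \<noteq> 0"
      then show False using supp \<open>K \<subseteq> _\<close> that by fastforce
    qed
  qed
qed

text \<open>\<open>dt\<close> and \<open>dy\<close> are defined by \<open>deriv\<close> on slices,
  whereas \<open>smooth\<close> provides a total derivative \<open>D\<close>. The chain rule along
  coordinate lines identifies \<open>D (1, 0)\<close> and \<open>D (0, 1)\<close> with them;
  linearity of \<open>D\<close> then covers every curve, rays included.\<close>

lemma test_function_derivatives:
  assumes "test_function \<phi>"
  shows has_dy: "((\<lambda>z. \<phi> (t, z)) has_real_derivative dy \<phi> (t, y)) (at y)"
    and has_derivative_along_ray:
      "((\<lambda>s. \<phi> (s, s * z)) has_real_derivative dt \<phi> (t, t * z) + z * dy \<phi> (t, t * z)) (at t)"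
proof -
  have curve: "((\<lambda>s. \<phi> (f s, g s)) has_real_derivative f' * dt \<phi> (f s, g s) + g' * dy \<phi> (f s, g s)) (at s)"
    if f: "(f has_real_derivative f') (at s)" and g: "(g has_real_derivative g') (at s)"
    for f g f' g' s
  proof -
    obtain D where D: "(\<phi> has_derivative D) (at (f s, g s))"
      using test_function_differentiable[OF assms] by (auto simp: differentiable_def)
    interpret D: linear D using D by (rule has_derivative_linear)
    \<comment> \<open>Stated for any curve through the point \<open>(f s, g s)\<close>, so that it
      serves the two coordinate lines as well as the given curve.\<close>
    have comp: "((\<lambda>r. \<phi> (u r, v r)) has_real_derivative D (u', v')) (at r)"
      if "(u has_real_derivative u') (at r)" "(v has_real_derivative v') (at r)"
        "u r = f s" "v r = g s" for u v u' v' r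
    proof -
      have "((\<lambda>r. (u r, v r)) has_derivative (\<lambda>h. h *\<^sub>R (u', v'))) (at r)"
        using has_derivative_Pair[OF that(1,2)[unfolded has_field_derivative_def]]
        by (simp add: mult.commute)
      then have "((\<lambda>r. \<phi> (u r, v r)) has_derivative (\<lambda>h. D (h *\<^sub>R (u', v')))) (at r)"
        by (rule has_derivative_compose) (simp add: that D)
      then show ?thesis
        by (simp only: D.scale has_field_derivative_def) (simp add: mult.commute[of _ "D _"])
    qed
    have "D (1, 0) = dt \<phi> (f s, g s)"
      using comp[of "\<lambda>r. r" 1 "f s" "\<lambda>_. g s" 0] by (auto simp: dt_def dest: DERIV_imp_deriv)
    moreover have "D (0, 1) = dy \<phi> (f s, g s)"
      using comp[of "\<lambda>_. f s" 0 "g s" "\<lambda>r. r" 1] by (auto simp: dy_def dest: DERIV_imp_deriv)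
    moreover have "D (f', g') = f' * D (1, 0) + g' * D (0, 1)"
      using D.add[of "f' *\<^sub>R (1, 0)" "g' *\<^sub>R (0, 1)"] by (simp only: D.scale) simp
    ultimately show ?thesis using comp[OF f g] by simp
  qed
  show "((\<lambda>z. \<phi> (t, z)) has_real_derivative dy \<phi> (t, y)) (at y)"
    using curve[of "\<lambda>_. t" 0 y "\<lambda>z. z" 1] by simp
  show "((\<lambda>s. \<phi> (s, s * z)) has_real_derivative dt \<phi> (t, t * z) + z * dy \<phi> (t, t * z)) (at t)"
    using curve[of "\<lambda>s. s" 1 t "\<lambda>s. s * z" z] DERIV_cmult_right[OF DERIV_ident, of z t UNIV]
    by simp
qed

section \<open>Integrability on the strip\<close>

text \<open>The velocity is unbounded in \<open>y\<close> and \<open>1 / fst x\<close> is unbounded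
  near time 0, so bounds are asked only on boxes within the strip. The condition is stable under
  products and yields integrability both on compact sets and against test functions.\<close>

definition strip_locally_bounded :: "(real \<times> real \<Rightarrow> real) \<Rightarrow> bool" where
  "strip_locally_bounded f \<longleftrightarrow> f \<in> borel_measurable borel \<and>
     (\<forall>R. \<exists>B. \<forall>t\<in>{1..2}. \<forall>y. \<bar>y\<bar> \<le> R \<longrightarrow> \<bar>f (t, y)\<bar> \<le> B)"

lemma strip_locally_boundedD:
  "strip_locally_bounded f \<Longrightarrow> f \<in> borel_measurable borel"
  by (simp add: strip_locally_bounded_def)

lemma strip_locally_bounded_mult:
  assumes "strip_locally_bounded f" "strip_locally_bounded g"
  shows "strip_locally_bounded (\<lambda>x. f x * g x)"
  unfolding strip_locally_bounded_def
proof (intro conjI allI)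
  note [measurable] = assms[THEN strip_locally_boundedD]
  show "(\<lambda>x. f x * g x) \<in> borel_measurable borel" by measurable
  fix R
  obtain B where B: "\<And>t y. t \<in> {1..2} \<Longrightarrow> \<bar>y\<bar> \<le> R \<Longrightarrow> \<bar>f (t, y)\<bar> \<le> B"
    using assms(1) unfolding strip_locally_bounded_def by metis
  obtain C where C: "\<And>t y. t \<in> {1..2} \<Longrightarrow> \<bar>y\<bar> \<le> R \<Longrightarrow> \<bar>g (t, y)\<bar> \<le> C"
    using assms(2) unfolding strip_locally_bounded_def by metis
  have "\<bar>f (t, y) * g (t, y)\<bar> \<le> B * C" if "t \<in> {1..2}" "\<bar>y\<bar> \<le> R" for t y
    unfolding abs_mult using B[OF that] C[OF that] by (intro mult_mono) auto
  then show "\<exists>B. \<forall>t\<in>{1..2}. \<forall>y. \<bar>y\<bar> \<le> R \<longrightarrow> \<bar>f (t, y) * g (t, y)\<bar> \<le> B"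
    by blast
qed

lemma strip_locally_bounded_velocity: "strip_locally_bounded (\<lambda>x. snd x / fst x)"
  unfolding strip_locally_bounded_def
proof (intro conjI allI)
  show "\<exists>B. \<forall>t\<in>{1..2}. \<forall>y. \<bar>y\<bar> \<le> R \<longrightarrow> \<bar>snd (t, y) / fst (t, y)\<bar> \<le> B" for R :: real
  proof (intro exI[of _ R] ballI allI impI)
    fix t y :: real assume "t \<in> {1..2}" "\<bar>y\<bar> \<le> R"
    then show "\<bar>snd (t, y) / fst (t, y)\<bar> \<le> R"
      using mult_left_mono[of 1 t R] order_trans[OF abs_ge_zero[of y], of R]
      by (auto simp: abs_divide divide_le_eq)
  qed
qed measurable

lemma strip_locally_bounded_inverse_time: "strip_locally_bounded (\<lambda>x. 1 / fst x)"
  unfolding strip_locally_bounded_def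
proof (intro conjI allI)
  show "\<exists>B. \<forall>t\<in>{1..2::real}. \<forall>y::real. \<bar>y\<bar> \<le> R \<longrightarrow> \<bar>1 / fst (t, y)\<bar> \<le> B" for R :: real
    by (intro exI[of _ 1]) auto
qed measurable

lemma strip_locally_bounded_profile:
  assumes [measurable]: "r \<in> borel_measurable borel" and "\<And>z. \<bar>r z\<bar> \<le> C"
  shows "strip_locally_bounded (\<lambda>x. r (snd x / fst x))"
  unfolding strip_locally_bounded_def using assms(2) by (intro conjI allI exI[of _ C]) auto

lemma strip_box_measurable [measurable]: "{1..2::real} \<times> {-R..R::real} \<in> sets borel"
  by (intro borel_closed closed_Times) auto

lemma strip_box_finite: "emeasure lborel ({1..2::real} \<times> {-R..R::real}) < \<infinity>"
  by (intro emeasure_bounded_finite bounded_Times) auto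

lemma locally_integrable_onI:
  fixes f :: "'a::euclidean_space \<Rightarrow> real"
  assumes [measurable]: "f \<in> borel_measurable borel"
    and "\<And>K. compact K \<Longrightarrow> K \<subseteq> S \<Longrightarrow> \<exists>B. \<forall>x\<in>K. \<bar>f x\<bar> \<le> B"
  shows "locally_integrable_on f S"
  unfolding locally_integrable_on_def
proof (intro allI impI)
  fix K assume K: "compact K \<and> K \<subseteq> S"
  then have "\<exists>B. \<forall>x\<in>K. \<bar>f x\<bar> \<le> B" by (intro assms(2)) simp_all
  then obtain B where B: "\<forall>x\<in>K. \<bar>f x\<bar> \<le> B" by (rule exE)
  have "K \<in> sets borel" using K by (intro borel_compact) simp
  moreover have "emeasure lborel K < \<infinity>"
    using K by (intro emeasure_bounded_finite compact_imp_bounded) simp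
  ultimately have "integrable lborel (\<lambda>x. indicator K x *\<^sub>R f x)"
    by (intro integrableI_bounded_set_indicator[where B=B]) (use B assms(1) in simp_all)
  then show "set_integrable lborel K f"
    unfolding set_integrable_def .
qed

lemma compact_strip_subset_box:
  assumes "compact K" "K \<subseteq> strip"
  obtains R where "K \<subseteq> {1..2} \<times> {-R..R}"
proof -
  obtain R where R: "\<And>x. x \<in> K \<Longrightarrow> norm x \<le> R"
    using compact_imp_bounded[OF assms(1)] unfolding bounded_iff by metis
  have "(t, y) \<in> {1..2} \<times> {-R..R}" if "(t, y) \<in> K" for t y
  proof -
    have "\<bar>y\<bar> \<le> R"
      using R[OF that] norm_snd_le[of y t] by (simp only: real_norm_def)
    moreover have "t \<in> {1..2}"
      using subsetD[OF assms(2) that] by (simp add: strip_def)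
    ultimately show ?thesis by auto
  qed
  then have "K \<subseteq> {1..2} \<times> {-R..R}" by (rule subrelI)
  then show ?thesis by (rule that)
qed

lemma strip_locally_bounded_integrable:
  assumes "strip_locally_bounded f"
  shows "locally_integrable_on f strip"
proof (rule locally_integrable_onI[OF strip_locally_boundedD[OF assms]])
  fix K :: "(real \<times> real) set" assume K: "compact K" "K \<subseteq> strip"
  then obtain R where R: "K \<subseteq> {1..2} \<times> {-R..R}" by (rule compact_strip_subset_box)
  obtain B where "\<And>t y. t \<in> {1..2} \<Longrightarrow> \<bar>y\<bar> \<le> R \<Longrightarrow> \<bar>f (t, y)\<bar> \<le> B"
    using assms unfolding strip_locally_bounded_def by metis
  moreover have "fst x \<in> {1..2} \<and> \<bar>snd x\<bar> \<le> R" if "x \<in> K" for x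
    using subsetD[OF R that] by (cases x) auto
  ultimately have "\<bar>f (fst x, snd x)\<bar> \<le> B" if "x \<in> K" for x
    using that by blast
  then have "\<forall>x\<in>K. \<bar>f x\<bar> \<le> B" unfolding prod.collapse by (rule ballI)
  then show "\<exists>B. \<forall>x\<in>K. \<bar>f x\<bar> \<le> B" by (rule exI)
qed

lemma strip_locally_bounded_test:
  assumes "strip_locally_bounded f" "test_function \<phi>"
  shows "set_integrable lborel strip (\<lambda>x. f x * \<phi> x)"
proof -
  note [measurable] = strip_locally_boundedD[OF assms(1)] test_function_measurable[OF assms(2)]
  obtain C where C: "0 < C" "\<And>x. \<bar>\<phi> x\<bar> \<le> C" using test_function_bounded assms(2) by metis
  obtain R where R: "0 < R" "\<And>t y. R \<le> \<bar>y\<bar> \<Longrightarrow> \<phi> (t, y) = 0"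
    using test_function_support assms(2) by metis
  obtain B where B: "\<And>t y. t \<in> {1..2} \<Longrightarrow> \<bar>y\<bar> \<le> R \<Longrightarrow> \<bar>f (t, y)\<bar> \<le> B"
    using assms unfolding strip_locally_bounded_def by metis
  have bd: "\<bar>f (t, y) * \<phi> (t, y)\<bar> \<le> B * C" if "t \<in> {1..2}" "\<bar>y\<bar> \<le> R" for t y
    unfolding abs_mult using B[OF that] C(2)[of "(t, y)"] by (intro mult_mono) auto
  show ?thesis
    unfolding set_integrable_def
  proof (rule integrableI_bounded_set[where A="{1..2} \<times> {-R..R}" and B="B * C"])
    show "AE x in lborel. x \<in> {1..2} \<times> {-R..R} \<longrightarrow> norm (indicat_real strip x *\<^sub>R (f x * \<phi> x)) \<le> B * C"
      using bd by (intro AE_I2) (auto simp: indicator_def strip_def abs_le_iff)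
    show "AE x in lborel. x \<notin> {1..2} \<times> {-R..R} \<longrightarrow> indicat_real strip x *\<^sub>R (f x * \<phi> x) = 0"
    proof (intro AE_I2 impI)
      fix x :: "real \<times> real" assume "x \<notin> {1..2} \<times> {-R..R}"
      then show "indicat_real strip x *\<^sub>R (f x * \<phi> x) = 0"
        using R(2)[of "snd x" "fst x"] by (cases x) (force simp: indicator_def strip_def)
    qed
  qed (use strip_box_finite in auto)
qed

section \<open>Integration along rays\<close>

text \<open>This removes the pressure and viscosity terms, which vanish at each time separately:
  there the pressure is constant in \<open>y\<close> and the velocity is linear in
  \<open>y\<close>.\<close>

lemma integral_strip_eq_0:
  fixes f :: "real \<times> real \<Rightarrow> real"
  assumes "set_integrable lborel strip f"
    and "\<And>t. t \<in> {1..2} \<Longrightarrow> (LINT y|lborel. f (t, y)) = 0"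
  shows "(LINT x:strip|lborel. f x) = 0"
proof -
  have "(LINT x:strip|lborel. f x) = (LINT t|lborel. LINT y|lborel. indicator strip (t, y) *\<^sub>R f (t, y))"
    unfolding set_lebesgue_integral_def
    by (rule integral_lborel_iterated) (use assms in \<open>simp add: set_integrable_def\<close>)
  also have "\<dots> = (LINT (t::real)|lborel. 0)"
  proof (rule Bochner_Integration.integral_cong[OF refl])
    fix t :: real
    have "indicator strip (t, y) = (indicator {1..2} t :: real)" for y
      by (simp add: strip_def indicator_def)
    then show "(LINT y|lborel. indicator strip (t, y) *\<^sub>R f (t, y)) = 0"
      using assms(2)[of t] by (auto simp: indicator_def)
  qed
  finally show ?thesis by simp
qed

lemma integral_derivative_compact_support:
  fixes F f :: "real \<Rightarrow> real"
  assumes "\<And>y. (F has_real_derivative f y) (at y)" "\<And>y. isCont f y" "0 < R"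
    and "\<And>y. R \<le> \<bar>y\<bar> \<Longrightarrow> F y = 0" "\<And>y. R \<le> \<bar>y\<bar> \<Longrightarrow> f y = 0"
  shows "(LINT y|lborel. f y) = 0"
proof -
  have "(LINT y|lborel. f y) = (LINT y|lborel. f y * indicator {-R..R} y)"
    using assms(5) by (intro Bochner_Integration.integral_cong refl) (force simp: indicator_def)
  also have "\<dots> = F R - F (-R)"
    using assms by (intro integral_FTC_Icc_real) auto
  finally show ?thesis using assms(3,4) by simp
qed

lemma integral_dy_eq_0:
  assumes "test_function \<phi>"
  shows "(LINT y|lborel. dy \<phi> (t, y)) = 0"
proof -
  note dy = test_function_dy[OF assms]
  obtain R where R: "0 < R" "\<And>t y. R \<le> \<bar>y\<bar> \<Longrightarrow> \<phi> (t, y) = 0"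
    using test_function_support assms by metis
  obtain S where S: "0 < S" "\<And>t y. S \<le> \<bar>y\<bar> \<Longrightarrow> dy \<phi> (t, y) = 0"
    using test_function_support dy by metis
  show ?thesis
  \<comment> \<open>\<open>test_function_support\<close> gives unrelated radii for
    \<open>\<phi>\<close> and its derivative, hence the maximum.\<close>
  proof (rule integral_derivative_compact_support[of "\<lambda>y. \<phi> (t, y)" _ "max R S"])
    show "isCont (\<lambda>y. dy \<phi> (t, y)) y" for y
      by (rule isCont_o2[OF _ test_function_isCont[OF dy]]) (intro continuous_intros)
  qed (use R S has_dy[OF assms] in auto)
qed

lemma integral_y_dy_dy_eq_0:
  assumes "test_function \<phi>"
  shows "(LINT y|lborel. y * dy (dy \<phi>) (t, y)) = 0"
proof -
  note dy = test_function_dy[OF assms]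
  note dydy = test_function_dy[OF dy]
  obtain R where R: "0 < R" "\<And>t y. R \<le> \<bar>y\<bar> \<Longrightarrow> \<phi> (t, y) = 0"
    using test_function_support assms by metis
  obtain S where S: "0 < S" "\<And>t y. S \<le> \<bar>y\<bar> \<Longrightarrow> dy \<phi> (t, y) = 0"
    using test_function_support dy by metis
  obtain T where T: "0 < T" "\<And>t y. T \<le> \<bar>y\<bar> \<Longrightarrow> dy (dy \<phi>) (t, y) = 0"
    using test_function_support dydy by metis
  show ?thesis
  \<comment> \<open>The primitive comes from integrating \<open>y * dy (dy \<phi>)\<close> by parts
    once.\<close>
  proof (rule integral_derivative_compact_support[of "\<lambda>y. y * dy \<phi> (t, y) - \<phi> (t, y)" _ "max R (max S T)"])
    show "((\<lambda>y. y * dy \<phi> (t, y) - \<phi> (t, y)) has_real_derivative y * dy (dy \<phi>) (t, y)) (at y)" for y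
      by (auto intro!: derivative_eq_intros has_dy[OF assms] has_dy[OF dy])
    show "isCont (\<lambda>y. y * dy (dy \<phi>) (t, y)) y" for y
      by (intro continuous_intros isCont_o2[OF _ test_function_isCont[OF dydy]])
  qed (use R S T in auto)
qed

text \<open>Substituting \<open>y = t z\<close> turns the integrand into \<open>w z\<close> times the derivative of
  \<open>\<lambda>t. \<phi> (t, t * z)\<close>. Both balance laws are of this form: \<open>w = r\<close> for mass, \<open>w z = r z * z\<close> for
  momentum.\<close>

lemma transport_identity:
  assumes "test_function \<phi>" and w [measurable]: "w \<in> borel_measurable borel"
    and bdd: "\<And>R. \<exists>B. \<forall>z. \<bar>z\<bar> \<le> R \<longrightarrow> \<bar>w z\<bar> \<le> B"
    and int: "set_integrable lborel strip
      (\<lambda>x. w (snd x / fst x) / fst x * (dt \<phi> x + snd x / fst x * dy \<phi> x))"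
  shows "(LINT x:strip|lborel. w (snd x / fst x) / fst x * (dt \<phi> x + snd x / fst x * dy \<phi> x))
     = - (LINT z|lborel. w z * \<phi> (1, z))"
proof -
  note dt = test_function_dt[OF assms(1)] and dy = test_function_dy[OF assms(1)]
  note [measurable] = test_function_measurable[OF dt] test_function_measurable[OF dy]
  define \<psi> where "\<psi> t z = dt \<phi> (t, t * z) + z * dy \<phi> (t, t * z)" for t z
  \<comment> \<open>The integrand in the coordinates \<open>(t, z)\<close>: the Jacobian
    \<open>t\<close> of \<open>y = t * z\<close> has cancelled the factor
    \<open>1 / t\<close>.\<close>
  define H where "H x = indicator {1..2} (fst x) * (w (snd x) * \<psi> (fst x) (snd x))" for x
  obtain C where C: "0 < C" "\<And>x. \<bar>dt \<phi> x\<bar> \<le> C" using test_function_bounded dt by metis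
  obtain D where D: "0 < D" "\<And>x. \<bar>dy \<phi> x\<bar> \<le> D" using test_function_bounded dy by metis
  obtain R where R: "0 < R" "\<And>t y. R \<le> \<bar>y\<bar> \<Longrightarrow> dt \<phi> (t, y) = 0"
    using test_function_support dt by metis
  obtain S where S: "0 < S" "\<And>t y. S \<le> \<bar>y\<bar> \<Longrightarrow> dy \<phi> (t, y) = 0"
    using test_function_support dy by metis
  define T where "T = max R S"
  have T: "0 < T" using R S by (simp add: T_def)
  \<comment> \<open>For \<open>t \<ge> 1\<close> the point \<open>t * z\<close> is at least as far
    out as \<open>z\<close>, so one cutoff in \<open>z\<close> works for all times.\<close>
  have \<psi>0: "\<psi> t z = 0" if "1 \<le> t" "T \<le> \<bar>z\<bar>" for t z
  proof -
    have "1 * T \<le> t * \<bar>z\<bar>" using that T by (intro mult_mono) auto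
    then have "R \<le> \<bar>t * z\<bar>" "S \<le> \<bar>t * z\<bar>" using that by (auto simp: T_def abs_mult)
    then show ?thesis using R S by (simp add: \<psi>_def)
  qed
  obtain B where B: "\<And>z. \<bar>z\<bar> \<le> T \<Longrightarrow> \<bar>w z\<bar> \<le> B" using bdd by metis
  have [measurable]: "(\<lambda>x. \<psi> (fst x) (snd x)) \<in> borel_measurable borel"
    unfolding \<psi>_def by measurable
  have H: "integrable lborel H"
  proof (rule integrableI_bounded_set[where A="{1..2} \<times> {-T..T}" and B="B * (C + T * D)"])
    show "H \<in> borel_measurable lborel" unfolding H_def[abs_def] by measurable
    have "\<bar>H (t, z)\<bar> \<le> B * (C + T * D)" if "1 \<le> t" "t \<le> 2" "\<bar>z\<bar> \<le> T" for t z
    proof -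
      have "\<bar>z * dy \<phi> (t, t * z)\<bar> \<le> T * D"
        unfolding abs_mult using that D(2)[of "(t, t * z)"] T by (intro mult_mono) auto
      then have "\<bar>\<psi> t z\<bar> \<le> C + T * D"
        using C(2)[of "(t, t * z)"] unfolding \<psi>_def by linarith
      then have "\<bar>w z * \<psi> t z\<bar> \<le> B * (C + T * D)"
        unfolding abs_mult using B[OF that(3)] by (intro mult_mono) auto
      then show ?thesis using that by (simp add: H_def)
    qed
    then show "AE x in lborel. x \<in> {1..2} \<times> {-T..T} \<longrightarrow> norm (H x) \<le> B * (C + T * D)"
      by (intro AE_I2) auto
    show "AE x in lborel. x \<notin> {1..2} \<times> {-T..T} \<longrightarrow> H x = 0"
      by (intro AE_I2) (auto simp: H_def indicator_def intro!: \<psi>0)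
  qed (use strip_box_finite in auto)
  have "(LINT x:strip|lborel. w (snd x / fst x) / fst x * (dt \<phi> x + snd x / fst x * dy \<phi> x)) =
    (LINT t|lborel. LINT y|lborel. indicator strip (t, y) *\<^sub>R
       (w (y / t) / t * (dt \<phi> (t, y) + y / t * dy \<phi> (t, y))))"
    unfolding set_lebesgue_integral_def
    by (subst integral_lborel_iterated) (use int in \<open>simp_all add: set_integrable_def\<close>)
  also have "\<dots> = (LINT t|lborel. LINT z|lborel. H (t, z))"
  proof (rule Bochner_Integration.integral_cong[OF refl])
    fix t :: real
    show "(LINT y|lborel. indicator strip (t, y) *\<^sub>R
       (w (y / t) / t * (dt \<phi> (t, y) + y / t * dy \<phi> (t, y)))) = (LINT z|lborel. H (t, z))"
    proof (cases "t \<in> {1..2}")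
      case True
      then have "(LINT y|lborel. indicator strip (t, y) *\<^sub>R
          (w (y / t) / t * (dt \<phi> (t, y) + y / t * dy \<phi> (t, y)))) =
        t * (LINT z|lborel. indicator strip (t, 0 + t * z) *\<^sub>R
          (w ((0 + t * z) / t) / t * (dt \<phi> (t, 0 + t * z) + (0 + t * z) / t * dy \<phi> (t, 0 + t * z))))"
        by (subst lborel_integral_real_affine[of t _ 0]) auto
      also have "\<dots> = (LINT z|lborel. H (t, z))"
        using True unfolding integral_mult_right_zero[symmetric]
        by (intro Bochner_Integration.integral_cong refl)
          (simp add: H_def \<psi>_def strip_def)
      finally show ?thesis .
    next
      case False
      then have "H (t, z) = 0" "(indicator strip (t, z) :: real) = 0" for z
        by (auto simp: H_def strip_def indicator_def)
      then show ?thesis by simp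
    qed
  qed
  \<comment> \<open>Integrating in time first makes \<open>w z\<close> a constant factor; what is
    left on each ray is an exact derivative.\<close>
  also have "\<dots> = (LINT z|lborel. LINT t|lborel. H (t, z))"
    using lborel_pair.Fubini_integral[of "\<lambda>t z. H (t, z)"] H by (simp add: lborel_prod)
  also have "\<dots> = (LINT z|lborel. - (w z * \<phi> (1, z)))"
  proof (rule Bochner_Integration.integral_cong[OF refl])
    fix z :: real
    have "(LINT t|lborel. H (t, z)) = (LINT t|lborel. w z * (\<psi> t z * indicator {1..2} t))"
      by (simp add: H_def mult_ac)
    also have "\<dots> = w z * (LINT t|lborel. \<psi> t z * indicator {1..2} t)"
      by simp
    also have "(LINT t|lborel. \<psi> t z * indicator {1..2} t) = \<phi> (2, 2 * z) - \<phi> (1, 1 * z)"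
    proof (rule integral_FTC_Icc_real)
      show "((\<lambda>s. \<phi> (s, s * z)) has_real_derivative \<psi> t z) (at t)" for t
        unfolding \<psi>_def by (rule has_derivative_along_ray[OF assms(1)])
      show "isCont (\<lambda>t. \<psi> t z) t" for t
        unfolding \<psi>_def
        by (intro continuous_intros isCont_o2[OF _ test_function_isCont[OF dt]]
            isCont_o2[OF _ test_function_isCont[OF dy]])
    qed simp
    \<comment> \<open>The support lies in \<open>t < 2\<close>, so the final time contributes
      nothing and only the initial data remain.\<close>
    also have "\<phi> (2, 2 * z) = 0"
      using test_function_support[OF assms(1)] by (metis order_refl)
    finally show "(LINT t|lborel. H (t, z)) = - (w z * \<phi> (1, z))" by simp
  qed
  finally show ?thesis by simp
qed

section \<open>Self-similar weak solutions\<close>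

lemma integrable_lborel_product:
  fixes u v :: "real \<Rightarrow> real"
  assumes u: "integrable lborel u" and v: "integrable lborel v"
  shows "integrable lborel (\<lambda>x. u (fst x) * v (snd x))"
proof -
  have "integrable (lborel \<Otimes>\<^sub>M lborel) (\<lambda>x. u (fst x) * v (snd x))"
  proof (rule lborel_pair.Fubini_integrable)
    show "(\<lambda>x. u (fst x) * v (snd x)) \<in> borel_measurable (lborel \<Otimes>\<^sub>M lborel)"
      using borel_measurable_integrable[OF u] borel_measurable_integrable[OF v] by measurable
  qed (use u v in \<open>simp_all add: abs_mult\<close>)
  then show ?thesis by (simp add: lborel_prod)
qed

text \<open>For \<open>t\<close> in \<open>{1..2}\<close> the argument \<open>1 / (a * t)\<close>
  runs through a compact part of \<open>{0<..}\<close>, and its derivative is bounded away from 0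
  there, so a change of variable transfers integrability from \<open>p\<close>.\<close>

lemma pressure_integrable:
  fixes a :: real
  assumes "locally_integrable_on p {0<..}" "0 < a"
  shows "set_integrable lborel {1..2} (\<lambda>t. p (1 / (a * t)))"
proof -
  \<comment> \<open>The substitution rule wants a nonnegative derivative, but
    \<open>1 / (a * t)\<close> decreases; hence the sign here and the reflected integrand
    \<open>p (- x)\<close>.\<close>
  define g where "g t = - (1 / (a * t))" for t :: real
  define g' where "g' t = 1 / (a * t\<^sup>2)" for t :: real
  have "{1 / (2 * a)..1 / a} \<subseteq> {0<..}"
    using assms(2) by (auto intro: order.strict_trans2[of _ "1 / (2 * a)"])
  then have "set_integrable lborel {1 / (2 * a)..1 / a} p"
    using assms(1) unfolding locally_integrable_on_def by blast
  then have "integrable lborel (\<lambda>x. indicator {1 / (2 * a)..1 / a} (0 + (-1) * x) *\<^sub>R p (0 + (-1) * x))"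
    unfolding set_integrable_def by (rule lborel_integrable_real_affine) simp
  also have "(\<lambda>x. indicator {1 / (2 * a)..1 / a} (0 + (-1) * x) *\<^sub>R p (0 + (-1) * x)) =
      (\<lambda>x. indicator {g 1..g 2} x *\<^sub>R p (- x))"
    by (rule ext) (auto simp: g_def split: split_indicator)
  finally have "set_integrable lborel {g 1..g 2} (\<lambda>x. p (- x))"
    by (simp add: set_integrable_def)
  then have "set_integrable lborel {1..2} (\<lambda>t. p (- g t) * g' t)"
  proof (rule integral_substitution(1))
    show "(g has_real_derivative g' t) (at t)" if "t \<in> {1..2}" for t
      unfolding g_def g'_def using that assms(2)
      by (auto intro!: derivative_eq_intros simp: power2_eq_square field_simps)
    show "continuous_on {1..2} g'"
      unfolding g'_def using assms(2) by (auto intro!: continuous_intros)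
  qed (use assms(2) in \<open>auto simp: g'_def\<close>)
  then have int: "integrable lborel (\<lambda>t. indicator {1..2} t *\<^sub>R (p (- g t) * g' t))"
    by (simp add: set_integrable_def)
  \<comment> \<open>Multiplying by \<open>a * t\<^sup>2\<close> undoes \<open>g'\<close>. This
    factor is at most \<open>4 * a\<close> for \<open>t \<le> 2\<close>, which supplies the
    majorant.\<close>
  have eq: "indicator {1..2} t *\<^sub>R p (1 / (a * t)) = indicator {1..2} t *\<^sub>R (p (- g t) * g' t) * (a * t\<^sup>2)" for t
    using assms(2) by (auto simp: g_def g'_def indicator_def)
  show ?thesis
    unfolding set_integrable_def
  proof (rule Bochner_Integration.integrable_bound[OF integrable_mult_right[OF int, of "4 * a"]])
    show "(\<lambda>t. indicator {1..2} t *\<^sub>R p (1 / (a * t))) \<in> borel_measurable lborel"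
      unfolding eq using borel_measurable_integrable[OF int] by measurable
    have "\<bar>indicator {1..2} t *\<^sub>R p (1 / (a * t))\<bar>
        \<le> \<bar>4 * a * (indicator {1..2} t *\<^sub>R (p (- g t) * g' t))\<bar>" for t :: real
    proof (cases "t \<in> {1..2}")
      case True
      then have "t\<^sup>2 \<le> 4" using power_mono[of t 2 2] by simp
      then have "a * t\<^sup>2 \<le> 4 * a" using assms(2) by simp
      then show ?thesis
        unfolding eq abs_mult using assms(2)
        by (subst mult.commute[of _ "\<bar>a\<bar> * _"]) (intro mult_right_mono, auto simp: abs_mult)
    qed simp
    then show "AE t in lborel. norm (indicator {1..2} t *\<^sub>R p (1 / (a * t)))
        \<le> norm (4 * a * (indicator {1..2} t *\<^sub>R (p (- g t) * g' t)))"
      by simp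
  qed
qed

lemma strip_time_locally_integrable:
  assumes "set_integrable lborel {1..2} P"
  shows "locally_integrable_on (\<lambda>x. P (fst x)) strip"
  unfolding locally_integrable_on_def
proof (intro allI impI)
  fix K :: "(real \<times> real) set" assume K: "compact K \<and> K \<subseteq> strip"
  then have [measurable]: "K \<in> sets borel" by (auto intro: borel_compact)
  obtain R where R: "K \<subseteq> {1..2} \<times> {-R..R}"
    using K compact_strip_subset_box by blast
  have "integrable lborel (\<lambda>x. (indicator {1..2} (fst x) *\<^sub>R P (fst x)) * indicator {-R..R} (snd x))"
    using assms by (intro integrable_lborel_product)
      (auto simp: set_integrable_def emeasure_lborel_Icc_eq intro!: integrable_real_indicator)
  then have "integrable lborel (\<lambda>x. indicator K x *\<^sub>R
      ((indicator {1..2} (fst x) *\<^sub>R P (fst x)) * indicator {-R..R} (snd x)))"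
    by (rule integrable_mult_indicator[rotated]) simp
  also have "(\<lambda>x. indicator K x *\<^sub>R ((indicator {1..2} (fst x) *\<^sub>R P (fst x)) * indicator {-R..R} (snd x)))
      = (\<lambda>x. indicator K x *\<^sub>R P (fst x))"
    using R by (auto simp: indicator_def fun_eq_iff)
  finally show "set_integrable lborel K (\<lambda>x. P (fst x))"
    by (simp add: set_integrable_def)
qed

text \<open>The same product serves as majorant, with \<open>\<bar>\<phi> x\<bar>\<close> bounded by
  \<open>C\<close> times the indicator of \<open>{-R..R}\<close> in \<open>y\<close>.\<close>

lemma strip_time_test_integrable:
  assumes "set_integrable lborel {1..2} P" "test_function \<phi>"
  shows "set_integrable lborel strip (\<lambda>x. P (fst x) * \<phi> x)"
proof -
  obtain C where C: "0 < C" "\<And>x. \<bar>\<phi> x\<bar> \<le> C" using test_function_bounded assms(2) by metis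
  obtain R where R: "0 < R" "\<And>t y. R \<le> \<bar>y\<bar> \<Longrightarrow> \<phi> (t, y) = 0"
    using test_function_support assms(2) by metis
  have [measurable]: "(\<lambda>t. indicator {1..2} t *\<^sub>R P t) \<in> borel_measurable borel"
    using assms(1) borel_measurable_integrable[of lborel] by (simp add: set_integrable_def)
  note [measurable] = test_function_measurable[OF assms(2)]
  have eq: "indicator strip x *\<^sub>R (P (fst x) * \<phi> x) = (indicator {1..2} (fst x) *\<^sub>R P (fst x)) * \<phi> x" for x
    by (cases x) (simp add: strip_def indicator_def)
  have int: "integrable lborel (\<lambda>x. (indicator {1..2} (fst x) *\<^sub>R P (fst x)) * (C * indicator {-R..R} (snd x)))"
    using assms(1) by (intro integrable_lborel_product[where v="\<lambda>y. C * indicator {-R..R} y"])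
      (auto simp: set_integrable_def emeasure_lborel_Icc_eq intro!: integrable_real_indicator)
  show ?thesis
    unfolding set_integrable_def eq
  proof (rule Bochner_Integration.integrable_bound[OF int])
    have "(\<lambda>x. (indicator {1..2} (fst x) *\<^sub>R P (fst x))) \<in> borel_measurable (borel :: (real \<times> real) measure)"
      by measurable
    then show "(\<lambda>x. (indicator {1..2} (fst x) *\<^sub>R P (fst x)) * \<phi> x) \<in> borel_measurable lborel"
      by simp
    have "\<bar>\<phi> x\<bar> \<le> \<bar>C * indicator {-R..R} (snd x)\<bar>" for x
    proof (cases "\<bar>snd x\<bar> \<le> R")
      case True
      then have "snd x \<in> {-R..R}" by auto
      then show ?thesis using C(1) C(2)[of x] by simp
    next
      case False
      then show ?thesis using R(2)[of "snd x" "fst x"] by simp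
    qed
    then show "AE x in lborel. norm ((indicator {1..2} (fst x) *\<^sub>R P (fst x)) * \<phi> x)
      \<le> norm ((indicator {1..2} (fst x) *\<^sub>R P (fst x)) * (C * indicator {-R..R} (snd x)))"
      by (auto simp: abs_mult[of "_ * P _"] intro!: mult_left_mono)
  qed
qed

text \<open>The velocity equals the constant \<open>z\<close> along the ray
  \<open>y = t * z\<close>, which also explains the initial velocity \<open>y\<close> at
  \<open>t = 1\<close>. The profile \<open>r\<close> may jump arbitrarily between its two
  values.\<close>

lemma self_similar_weak_solution:
  assumes "0 < a" "0 < b" "locally_integrable_on p {0<..}"
    and p: "\<And>t. t \<in> {1..2} \<Longrightarrow> p (1 / (a * t)) = p (1 / (b * t))"
    and [measurable]: "r \<in> borel_measurable borel"
    and r: "\<And>z. r z \<in> {1 / a, 1 / b}"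
  shows "weak_solution p \<mu> r (\<lambda>y. y) (\<lambda>x. r (snd x / fst x) / fst x) (\<lambda>x. snd x / fst x)"
proof -
  define \<rho> where "\<rho> x = r (snd x / fst x) / fst x" for x
  define u :: "real \<times> real \<Rightarrow> real" where "u x = snd x / fst x" for x
  define P where "P t = p (1 / (a * t))" for t
  have r_pos: "0 < r z" for z using r[of z] assms(1,2) by auto
  have r_le: "\<bar>r z\<bar> \<le> 1 / a + 1 / b" for z using r[of z] assms(1,2) by auto
  have u_lb: "strip_locally_bounded u"
    unfolding u_def[abs_def] by (rule strip_locally_bounded_velocity)
  have \<rho>_lb: "strip_locally_bounded \<rho>"
    using strip_locally_bounded_mult[OF strip_locally_bounded_profile[OF assms(5) r_le]
        strip_locally_bounded_inverse_time]
    by (simp add: \<rho>_def[abs_def])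
  note \<rho>u_lb = strip_locally_bounded_mult[OF \<rho>_lb u_lb]
  note \<rho>uu_lb = strip_locally_bounded_mult[OF \<rho>u_lb u_lb]
  have P: "set_integrable lborel {1..2} P"
    unfolding P_def using assms by (intro pressure_integrable)
  \<comment> \<open>The density at time \<open>t\<close> is \<open>1 / (a * t)\<close> or
    \<open>1 / (b * t)\<close>. The two pressures are known to agree for \<open>t\<close> in
    \<open>{1..2}\<close> only, so later rewriting stays inside the strip.\<close>
  have p\<rho>: "p (\<rho> x) = P (fst x)" if "x \<in> strip" for x
    using that r[of "snd x / fst x"] p[of "fst x"] by (auto simp: \<rho>_def P_def strip_def)
  have "locally_integrable_on (\<lambda>x. p (\<rho> x)) strip"
    unfolding locally_integrable_on_def
  proof (intro allI impI)
    fix K :: "(real \<times> real) set" assume K: "compact K \<and> K \<subseteq> strip"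
    then have "set_integrable lborel K (\<lambda>x. P (fst x))"
      using strip_time_locally_integrable[OF P] by (auto simp: locally_integrable_on_def)
    then show "set_integrable lborel K (\<lambda>x. p (\<rho> x))"
      by (rule set_integrable_cong[THEN iffD1, rotated 3]) (use K p\<rho> in auto)
  qed
  moreover have "locally_integrable_on \<rho> strip" "locally_integrable_on u strip"
    "locally_integrable_on (\<lambda>x. \<rho> x * u x) strip" "locally_integrable_on (\<lambda>x. \<rho> x * (u x)\<^sup>2) strip"
    using strip_locally_bounded_integrable[OF \<rho>_lb] strip_locally_bounded_integrable[OF u_lb]
      strip_locally_bounded_integrable[OF \<rho>u_lb] strip_locally_bounded_integrable[OF \<rho>uu_lb]
    by (simp_all add: power2_eq_square mult.assoc)
  moreover have "locally_integrable_on r UNIV"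
    using r_le by (intro locally_integrable_onI) auto
  moreover have "locally_integrable_on (\<lambda>y. r y * y) UNIV"
  proof (rule locally_integrable_onI)
    fix K :: "real set" assume "compact K"
    then obtain R where R: "\<And>y. y \<in> K \<Longrightarrow> \<bar>y\<bar> \<le> R"
      using compact_imp_bounded[of K] unfolding bounded_iff by auto
    have "\<bar>r y * y\<bar> \<le> (1 / a + 1 / b) * R" if "y \<in> K" for y
      unfolding abs_mult using r_le[of y] R[OF that] assms by (intro mult_mono) auto
    then show "\<exists>B. \<forall>y\<in>K. \<bar>r y * y\<bar> \<le> B" by blast
  qed measurable
  moreover have "(LINT x:strip|lborel. \<rho> x * dt \<phi> x + \<rho> x * u x * dy \<phi> x)
      + (LINT y|lborel. r y * \<phi> (1, y)) = 0" if \<phi>: "test_function \<phi>" for \<phi>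
  proof -
    have eq: "\<rho> x * dt \<phi> x + \<rho> x * u x * dy \<phi> x
      = r (snd x / fst x) / fst x * (dt \<phi> x + snd x / fst x * dy \<phi> x)" for x
      by (simp add: \<rho>_def u_def algebra_simps)
    have "set_integrable lborel strip (\<lambda>x. \<rho> x * dt \<phi> x + \<rho> x * u x * dy \<phi> x)"
      by (intro set_integral_add strip_locally_bounded_test \<rho>_lb \<rho>u_lb
          test_function_dt[OF \<phi>] test_function_dy[OF \<phi>])
    then show ?thesis
      unfolding eq using r_le by (subst transport_identity[OF \<phi>]) auto
  qed
  moreover have "(LINT x:strip|lborel. \<rho> x * u x * dt \<phi> x + (\<rho> x * (u x)\<^sup>2 + p (\<rho> x)) * dy \<phi> x
                                + \<mu> * u x * dy (dy \<phi>) x)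
      + (LINT y|lborel. r y * y * \<phi> (1, y)) = 0" if \<phi>: "test_function \<phi>" for \<phi>
  proof -
    note dt = test_function_dt[OF \<phi>] and dy = test_function_dy[OF \<phi>]
    note dydy = test_function_dy[OF dy]
    \<comment> \<open>The inertial part,
      \<open>\<rho> u (\<phi>\<^sub>t + u \<phi>\<^sub>y)\<close>. It is split off from pressure and
      viscosity because it alone balances the initial momentum.\<close>
    define T where "T x = \<rho> x * u x * dt \<phi> x + \<rho> x * u x * u x * dy \<phi> x" for x
    have T_eq: "T x = r (snd x / fst x) * (snd x / fst x) / fst x * (dt \<phi> x + snd x / fst x * dy \<phi> x)" for x
      by (simp add: T_def \<rho>_def u_def algebra_simps add_divide_distrib)
    have T: "set_integrable lborel strip T"
      unfolding T_def by (intro set_integral_add strip_locally_bounded_test \<rho>u_lb \<rho>uu_lb dt dy)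
    have pressure: "set_integrable lborel strip (\<lambda>x. P (fst x) * dy \<phi> x)"
      by (rule strip_time_test_integrable[OF P dy])
    have viscosity: "set_integrable lborel strip (\<lambda>x. u x * dy (dy \<phi>) x)"
      by (rule strip_locally_bounded_test[OF u_lb dydy])
    have "(LINT x:strip|lborel. \<rho> x * u x * dt \<phi> x + (\<rho> x * (u x)\<^sup>2 + p (\<rho> x)) * dy \<phi> x
                                + \<mu> * u x * dy (dy \<phi>) x)
      = (LINT x:strip|lborel. T x + P (fst x) * dy \<phi> x + \<mu> * (u x * dy (dy \<phi>) x))"
      by (rule set_lebesgue_integral_cong)
        (auto simp: T_def p\<rho> power2_eq_square algebra_simps)
    also have "\<dots> = (LINT x:strip|lborel. T x) + (LINT x:strip|lborel. P (fst x) * dy \<phi> x)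
        + \<mu> * (LINT x:strip|lborel. u x * dy (dy \<phi>) x)"
      using T pressure viscosity by (simp add: set_integral_add)
    also have "(LINT x:strip|lborel. P (fst x) * dy \<phi> x) = 0"
      by (rule integral_strip_eq_0[OF pressure]) (simp add: integral_dy_eq_0[OF \<phi>])
    also have "(LINT x:strip|lborel. u x * dy (dy \<phi>) x) = 0"
      by (rule integral_strip_eq_0[OF viscosity])
        (simp add: u_def integral_y_dy_dy_eq_0[OF \<phi>])
    also have "(LINT x:strip|lborel. T x) = - (LINT y|lborel. r y * y * \<phi> (1, y))"
      unfolding T_eq
    proof (rule transport_identity[OF \<phi>])
      show "\<exists>B. \<forall>z. \<bar>z\<bar> \<le> R \<longrightarrow> \<bar>r z * z\<bar> \<le> B" for R
        unfolding abs_mult using assms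
        by (intro exI[of _ "(1 / a + 1 / b) * R"] allI impI mult_mono r_le) auto
    qed (use T in \<open>simp_all add: T_eq[abs_def]\<close>)
    finally show ?thesis by simp
  qed
  moreover have "AE x in lborel. x \<in> strip \<longrightarrow> 0 < \<rho> x"
    using r_pos by (intro AE_I2) (auto simp: strip_def \<rho>_def)
  ultimately have "weak_solution p \<mu> r (\<lambda>y. y) \<rho> u"
    using r_pos unfolding weak_solution_def by simp
  then show ?thesis by (simp add: \<rho>_def[abs_def] u_def[abs_def])
qed

section \<open>Oscillating densities\<close>

lemma set_integrable_bounded_mult:
  fixes f h :: "'a::euclidean_space \<Rightarrow> real"
  assumes h: "set_integrable lborel S h" and f: "f \<in> borel_measurable borel"
    and bound: "\<And>x. x \<in> S \<Longrightarrow> \<bar>f x\<bar> \<le> C"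
  shows "set_integrable lborel S (\<lambda>x. f x * h x)"
proof -
  have int: "integrable lborel (\<lambda>x. indicator S x *\<^sub>R h x)"
    using h by (simp add: set_integrable_def)
  have eq: "(\<lambda>x. indicator S x *\<^sub>R (f x * h x)) = (\<lambda>x. f x * (indicator S x *\<^sub>R h x))"
    by auto
  have "\<bar>f x * (indicator S x *\<^sub>R h x)\<bar> \<le> \<bar>C * (indicator S x *\<^sub>R h x)\<bar>" for x
  proof (cases "x \<in> S")
    case True
    then have "\<bar>f x\<bar> \<le> \<bar>C\<bar>" using bound[OF True] by simp
    then show ?thesis by (simp only: abs_mult mult_right_mono abs_ge_zero)
  qed simp
  then show ?thesis
    unfolding set_integrable_def eq using f borel_measurable_integrable[OF int]
    by (intro Bochner_Integration.integrable_bound[OF integrable_mult_right[OF int, of C]]) auto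
qed

lemma bounded_in_Linfty:
  fixes f :: "'a::euclidean_space \<Rightarrow> real"
  assumes [measurable]: "S \<in> sets borel" "f \<in> borel_measurable borel"
    and "\<And>x. x \<in> S \<Longrightarrow> \<bar>f x\<bar> \<le> C"
  shows "in_Linfty S f"
  unfolding in_Linfty_def set_borel_measurable_def
  using assms(3) by (auto intro!: exI[of _ C])

text \<open>The bounded amplitude \<open>k\<close> is moved onto the test function:
  \<open>k x * h x\<close> is again integrable, so \<open>null\<close> applies to it. A general
  \<open>S\<close> serves both the initial interval and \<open>Q\<close>.\<close>

lemma weak_star_converges_oscillation:
  fixes g k :: "'a::euclidean_space \<Rightarrow> real" and \<sigma> :: "nat \<Rightarrow> 'a \<Rightarrow> real"
  assumes S [measurable]: "S \<in> sets borel"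
    and [measurable]: "g \<in> borel_measurable borel" "k \<in> borel_measurable borel"
      "\<And>n. \<sigma> n \<in> borel_measurable borel"
    and g: "\<And>x. x \<in> S \<Longrightarrow> \<bar>g x\<bar> \<le> C" and k: "\<And>x. x \<in> S \<Longrightarrow> \<bar>k x\<bar> \<le> D"
    and \<sigma>: "\<And>n x. \<bar>\<sigma> n x\<bar> = 1"
    and null: "\<And>h :: 'a \<Rightarrow> real. set_integrable lborel S h \<Longrightarrow>
      (\<lambda>n. LINT x|lborel. \<sigma> n x * (indicator S x * h x)) \<longlonglongrightarrow> 0"
  shows "weak_star_converges S (\<lambda>n x. g x + k x * \<sigma> n x) g"
  unfolding weak_star_converges_def
proof (intro conjI allI impI)
  show "in_Linfty S g" by (rule bounded_in_Linfty[OF _ _ g]) auto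
  fix n
  have "\<bar>g x + k x * \<sigma> n x\<bar> \<le> C + D" if "x \<in> S" for x
    using abs_triangle_ineq[of "g x" "k x * \<sigma> n x"] g[OF that] k[OF that] by (simp add: abs_mult \<sigma>)
  then show "in_Linfty S (\<lambda>x. g x + k x * \<sigma> n x)"
    by (intro bounded_in_Linfty[where C="C + D"]) auto
next
  fix h :: "'a \<Rightarrow> real" assume h: "set_integrable lborel S h"
  have kh: "set_integrable lborel S (\<lambda>x. k x * h x)"
    by (rule set_integrable_bounded_mult[OF h _ k]) auto
  have gh: "set_integrable lborel S (\<lambda>x. g x * h x)"
    by (rule set_integrable_bounded_mult[OF h _ g]) auto
  have \<sigma>kh: "set_integrable lborel S (\<lambda>x. \<sigma> n x * (k x * h x))" for n
    by (rule set_integrable_bounded_mult[OF kh, where C=1]) (auto simp: \<sigma>)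
  have "(LINT x:S|lborel. (g x + k x * \<sigma> n x) * h x) =
      (LINT x:S|lborel. g x * h x) + (LINT x|lborel. \<sigma> n x * (indicator S x * (k x * h x)))" for n
  proof -
    have "(LINT x:S|lborel. (g x + k x * \<sigma> n x) * h x) =
      (LINT x:S|lborel. g x * h x + \<sigma> n x * (k x * h x))"
      by (simp add: algebra_simps)
    also have "\<dots> = (LINT x:S|lborel. g x * h x) + (LINT x:S|lborel. \<sigma> n x * (k x * h x))"
      by (rule set_integral_add[OF gh \<sigma>kh])
    also have "(LINT x:S|lborel. \<sigma> n x * (k x * h x)) = (LINT x|lborel. \<sigma> n x * (indicator S x * (k x * h x)))"
      unfolding set_lebesgue_integral_def by (simp add: mult_ac)
    finally show ?thesis .
  qed
  then show "(\<lambda>n. LINT x:S|lborel. (g x + k x * \<sigma> n x) * h x) \<longlonglongrightarrow> (LINT x:S|lborel. g x * h x)"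
    using tendsto_add[OF tendsto_const null[OF kh]] by simp
qed

lemma bounded_powr_set_integrable:
  fixes f :: "'a::euclidean_space \<Rightarrow> real"
  assumes [measurable]: "S \<in> sets borel" "f \<in> borel_measurable borel"
    and "emeasure lborel S < \<infinity>" "\<And>x. x \<in> S \<Longrightarrow> \<bar>f x\<bar> \<le> C" "0 \<le> r"
  shows "set_integrable lborel S (\<lambda>x. \<bar>f x\<bar> powr r)"
  unfolding set_integrable_def using assms
  by (intro integrableI_bounded_set_indicator[where B="C powr r"]) (auto intro!: powr_mono2)

text \<open>Since \<open>\<bar>\<sigma> n x\<bar> = 1\<close>, the distance integrand is
  \<open>\<bar>k x\<bar> powr r\<close> for every \<open>n\<close>. A constant sequence of integrals
  tending to 0 would be 0, against the lower bound \<open>\<delta>\<close> on a set of positive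
  measure.\<close>

lemma not_Lp_converges_oscillation:
  fixes g k :: "'a::euclidean_space \<Rightarrow> real" and \<sigma> :: "nat \<Rightarrow> 'a \<Rightarrow> real"
  assumes [measurable]: "S \<in> sets borel" "k \<in> borel_measurable borel"
    and S: "emeasure lborel S < \<infinity>" "0 < measure lborel S"
    and k: "\<And>x. x \<in> S \<Longrightarrow> \<bar>k x\<bar> \<le> D" "\<And>x. x \<in> S \<Longrightarrow> \<delta> \<le> \<bar>k x\<bar>" and "0 < \<delta>" "0 \<le> r"
    and \<sigma>: "\<And>n x. \<bar>\<sigma> n x\<bar> = 1"
  shows "\<not> Lp_converges r S (\<lambda>n x. g x + k x * \<sigma> n x) g"
proof
  assume "Lp_converges r S (\<lambda>n x. g x + k x * \<sigma> n x) g"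
  then have "(\<lambda>n::nat. LINT x:S|lborel. \<bar>k x\<bar> powr r) \<longlonglongrightarrow> 0"
    by (simp add: Lp_converges_def abs_mult \<sigma>)
  then have "(LINT x:S|lborel. \<bar>k x\<bar> powr r) = 0"
    by (simp add: LIMSEQ_const_iff)
  moreover have "(LINT x:S|lborel. \<delta> powr r) \<le> (LINT x:S|lborel. \<bar>k x\<bar> powr r)"
  proof (rule set_integral_mono)
    show "set_integrable lborel S (\<lambda>x. \<bar>k x\<bar> powr r)"
      using S k assms(8) by (intro bounded_powr_set_integrable) auto
    show "set_integrable lborel S (\<lambda>x. \<delta> powr r)"
      using S by (auto simp: set_integrable_def intro!: integrable_real_indicator)
    show "\<delta> powr r \<le> \<bar>k x\<bar> powr r" if "x \<in> S" for x
      using k(2)[OF that] assms by (intro powr_mono2) auto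
  qed
  moreover have "(LINT x:S|lborel. \<delta> powr r) = measure lborel S * \<delta> powr r"
    by (simp add: set_lebesgue_integral_def)
  ultimately show False using S \<open>0 < \<delta>\<close> by (simp add: mult_le_0_iff)
qed

section \<open>Assembling the sequence of solutions\<close>

lemma weak_star_converges_const:
  "in_Linfty S f \<Longrightarrow> weak_star_converges S (\<lambda>_. f) f"
  by (simp add: weak_star_converges_def)

lemma Lp_converges_const:
  "in_Lp r S f \<Longrightarrow> Lp_converges r S (\<lambda>_. f) f"
  by (simp add: Lp_converges_def set_lebesgue_integral_def)

lemma emeasure_Q: "emeasure lborel Q = 2"
proof -
  have "emeasure (lborel \<Otimes>\<^sub>M lborel) ({1..2::real} \<times> {-1<..<1::real}) = 2"
    by (subst lborel.emeasure_pair_measure_Times) auto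
  then show ?thesis by (simp add: Q_def lborel_prod)
qed

text \<open>A constant sequence of solutions, such as the one with \<open>r = 1 / a\<close>, would
  meet all the positive convergence clauses; the negated \<open>Lp_converges\<close> clauses demand
  genuine oscillation.\<close>

theorem theorem5p2:
  fixes \<mu> a b :: real and p :: "real \<Rightarrow> real"
  assumes "0 < \<mu>"
    and "0 < a" and "a < 2 * a" and "2 * a < b" and "b < 2 * b"
    and "locally_integrable_on p {0<..}"
    and "\<And>t. t \<in> {1..2} \<Longrightarrow> p (1 / (a * t)) = p (1 / (b * t))"
  shows "\<exists>(\<rho>0 :: nat \<Rightarrow> real \<Rightarrow> real) (u0 :: nat \<Rightarrow> real \<Rightarrow> real)
            (\<rho>0_lim :: real \<Rightarrow> real) (u0_lim :: real \<Rightarrow> real)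
            (\<rho> :: nat \<Rightarrow> real \<times> real \<Rightarrow> real) (u :: nat \<Rightarrow> real \<times> real \<Rightarrow> real)
            (\<rho>_lim :: real \<times> real \<Rightarrow> real) (u_lim :: real \<times> real \<Rightarrow> real).
      weak_star_converges {-1<..<1} \<rho>0 \<rho>0_lim \<and>
      weak_star_converges {-1<..<1} u0 u0_lim \<and>
      (\<forall>r\<ge>1. \<not> Lp_converges r {-1<..<1} \<rho>0 \<rho>0_lim) \<and>
      (\<forall>n. weak_solution p \<mu> (\<rho>0 n) (u0 n) (\<rho> n) (u n)) \<and>
      weak_star_converges Q \<rho> \<rho>_lim \<and>
      (\<forall>r\<ge>1. \<not> Lp_converges r Q \<rho> \<rho>_lim) \<and>
      (\<forall>r\<ge>1. Lp_converges r Q u u_lim)"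
proof -
  \<comment> \<open>Chosen so that \<open>m + c = 1 / a\<close> and \<open>m - c = 1 / b\<close>.
    The mean \<open>m\<close> becomes the weak limit of the initial densities, and
    \<open>a < b\<close> makes the amplitude \<open>c\<close> positive.\<close>
  define m where "m = (1 / a + 1 / b) / 2"
  define c where "c = (1 / a - 1 / b) / 2"
  define \<rho>0 where "\<rho>0 n z = m + c * square_wave n z" for n z
  \<comment> \<open>This is \<open>\<rho>0 n (snd x / fst x) / fst x\<close>, split into limit and
    amplitude times wave as the oscillation lemmas expect.\<close>
  define \<rho> where "\<rho> n x = m / fst x + c / fst x * square_wave n (snd x / fst x)" for n and x :: "real \<times> real"
  define u :: "real \<times> real \<Rightarrow> real" where "u x = snd x / fst x" for x
  have c: "0 < c" using assms by (simp add: c_def field_simps)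
  have [measurable]: "u \<in> borel_measurable borel" unfolding u_def[abs_def] by measurable
  have u_le: "\<bar>u x\<bar> \<le> 1" if "x \<in> Q" for x
    using that by (auto simp: u_def Q_def abs_divide divide_le_eq)
  \<comment> \<open>From \<open>1 \<le> t \<le> 2\<close>. The lower estimate keeps the amplitude
    \<open>c / fst x\<close> above \<open>c / 2\<close>, the \<open>\<delta>\<close> that excludes
    strong convergence on \<open>Q\<close>.\<close>
  have Q_div: "\<bar>d / fst x\<bar> \<le> \<bar>d\<bar>" "\<bar>d\<bar> / 2 \<le> \<bar>d / fst x\<bar>" if "x \<in> Q" for d x
  proof -
    have "1 \<le> fst x" "fst x \<le> 2" using that by (auto simp: Q_def)
    then show "\<bar>d / fst x\<bar> \<le> \<bar>d\<bar>" "\<bar>d\<bar> / 2 \<le> \<bar>d / fst x\<bar>"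
      using divide_left_mono[of 1 "fst x" "\<bar>d\<bar>"] divide_left_mono[of "fst x" 2 "\<bar>d\<bar>"]
      by (auto simp: abs_divide)
  qed
  have initial: "weak_star_converges {-1<..<1} \<rho>0 (\<lambda>_. m)"
    unfolding \<rho>0_def[abs_def]
  proof (rule weak_star_converges_oscillation[where C="\<bar>m\<bar>" and D="\<bar>c\<bar>"])
    fix h :: "real \<Rightarrow> real" assume h: "set_integrable lborel {-1<..<1} h"
    have eq: "indicator {-1<..<1} z *\<^sub>R h z * indicator {-1..1} z = indicator {-1<..<1} z * h z" for z
      by (auto split: split_indicator)
    show "(\<lambda>n. LINT z|lborel. square_wave n z * (indicator {-1<..<1} z * h z)) \<longlonglongrightarrow> 0"
      using square_wave_weakly_null_unit_interval[OF h[unfolded set_integrable_def]]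
      unfolding eq .
  qed auto
  have initial_strong: "\<not> Lp_converges r {-1<..<1} \<rho>0 (\<lambda>_. m)" if "r \<ge> 1" for r
    unfolding \<rho>0_def[abs_def]
    by (rule not_Lp_converges_oscillation[where D=c and \<delta>=c]) (use c that in auto)
  have density: "weak_star_converges Q \<rho> (\<lambda>x. m / fst x)"
    unfolding \<rho>_def[abs_def]
  proof (rule weak_star_converges_oscillation[where C="\<bar>m\<bar>" and D="\<bar>c\<bar>"])
    show "\<bar>m / fst x\<bar> \<le> \<bar>m\<bar>" "\<bar>c / fst x\<bar> \<le> \<bar>c\<bar>" if "x \<in> Q" for x
      using that by (rule Q_div(1))+
  qed (auto intro: square_wave_weakly_null_Q)
  have density_strong: "\<not> Lp_converges r Q \<rho> (\<lambda>x. m / fst x)" if "r \<ge> 1" for r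
    unfolding \<rho>_def[abs_def]
  proof (rule not_Lp_converges_oscillation[where D="\<bar>c\<bar>" and \<delta>="\<bar>c\<bar> / 2"])
    show "\<bar>c / fst x\<bar> \<le> \<bar>c\<bar>" "\<bar>c\<bar> / 2 \<le> \<bar>c / fst x\<bar>" if "x \<in> Q" for x
      using that by (rule Q_div)+
  qed (use c that in \<open>auto simp: emeasure_Q measure_def\<close>)
  have "in_Linfty {-1<..<1} (\<lambda>y::real. y)"
    by (rule bounded_in_Linfty[where C=1]) auto
  then have velocity0: "weak_star_converges {-1<..<1} (\<lambda>_ y. y) (\<lambda>y::real. y)"
    by (rule weak_star_converges_const)
  have "in_Lp r Q u" if "r \<ge> 1" for r
    unfolding in_Lp_def
    using that u_le bounded_powr_set_integrable[of Q u 1 r]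
    by (auto simp: emeasure_Q set_borel_measurable_def)
  then have velocity: "Lp_converges r Q (\<lambda>_. u) u" if "r \<ge> 1" for r
    using that by (intro Lp_converges_const)
  have solution: "weak_solution p \<mu> (\<rho>0 n) (\<lambda>y. y) (\<rho> n) u" for n
  proof -
    have "weak_solution p \<mu> (\<rho>0 n) (\<lambda>y. y) (\<lambda>x. \<rho>0 n (snd x / fst x) / fst x) (\<lambda>x. snd x / fst x)"
    proof (rule self_similar_weak_solution[OF _ _ assms(6,7)])
      show "\<rho>0 n \<in> borel_measurable borel" unfolding \<rho>0_def[abs_def] by measurable
      show "\<rho>0 n z \<in> {1 / a, 1 / b}" for z
        by (simp add: \<rho>0_def square_wave_def m_def c_def field_simps)
    qed (use assms in auto)
    then show ?thesis
      by (simp add: \<rho>_def[abs_def] \<rho>0_def u_def[abs_def] add_divide_distrib)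
  qed
  show ?thesis
    using initial initial_strong density density_strong velocity0 velocity solution
    by (intro exI[of _ \<rho>0] exI[of _ "\<lambda>_ y. y"] exI[of _ "\<lambda>_. m"] exI[of _ "\<lambda>y. y"]
        exI[of _ \<rho>] exI[of _ "\<lambda>_. u"] exI[of _ "\<lambda>x. m / fst x"] exI[of _ u]) auto
qed

end
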